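(* Let $\mathbf{A}=(A;\wedge,\vee,\neg,0,1,\bot,\top)$ be a DFg-algebra, and put $\Diamond x:=x\wedge\top$ and $\Diamond(\mathbf{A}):=(\Diamond[A];\wedge,\vee,0,\top)$. Then $\mathbf{A}$ is isomorphic to a DFg-twist-algebra over $\Diamond(\mathbf{A})$, as witnessed by the map $\iota\colon\mathbf{A}\to\Diamond(\mathbf{A})\times\Diamond(\mathbf{A})$, $a\mapsto(\Diamond a,\Diamond\neg a)$.
   Context: A De Morgan algebra is a bounded distributive lattice $(A;\wedge,\vee,0,1)$ with a unary operation $\neg$ satisfying $\neg\neg a=a$ and $\neg(a\wedge b)=\neg a\vee\neg b$. A DFg-algebra is an algebra $(A;\wedge,\vee,\neg,0,1,\bot,\top)$ such that $(A;\wedge,\vee,\neg,0,1)$ is a De Morgan algebra, $\neg\bot=\bot$, $\neg\top=\top$, and $\bot\wedge\top=0$. $\Diamond(\mathbf{A})$ carries the operations of $\mathbf{A}$ restricted to $\Diamond[A]=\{a\wedge\top:a\in A\}$; it is a bounded distributive lattice with least element $0$ and greatest element $\top$. For a bounded distributive lattice $\mathbf{L}=(L;\wedge,\vee,0,1)$, the full DFg-twist-algebra $\mathbf{L}^{\bowtie}$ has universe $L\times L$ and operations $(x_1,x_2)\wedge(y_1,y_2):=(x_1\wedge y_1,x_2\vee y_2)$, $\neg(x_1,x_2):=(x_2,x_1)$, $\top:=(1,1)$, $\bot:=(0,0)$; moreover $x\vee y:=\neg(\neg x\wedge\neg y)$, and the bounds are $(0,1)$ (bottom) and $(1,0)$ (top).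 A DFg-twist-algebra over $\mathbf{L}$ is any subalgebra $\mathbf{C}\leqslant\mathbf{L}^{\bowtie}$ such that $\pi_1[C]=L$, where $\pi_1$ is the first projection. *)

theory Defs
  imports "HOL-Algebra.Congruence"
begin

text \<open>
  Algebras are records with an explicit carrier, in the style of HOL-Algebra, because
  \<open>\<Diamond>(A)\<close> and twist-algebras live on proper subsets of a type and have different constants.
  The lattices are given by equations in the signature \<open>(\<and>, \<or>, 0, 1)\<close>, rather than by an order.
\<close>

record 'a bounded_lat = "'a partial_object" +
  meet :: "'a \<Rightarrow> 'a \<Rightarrow> 'a" (infixl "\<sqinter>\<index>" 70)
  join :: "'a \<Rightarrow> 'a \<Rightarrow> 'a" (infixl "\<squnion>\<index>" 65)
  zero :: 'a ("\<zero>\<index>")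
  one :: 'a ("\<one>\<index>")

record 'a de_morgan = "'a bounded_lat" +
  neg :: "'a \<Rightarrow> 'a" ("\<sim>\<index> _" [81] 80)

text \<open>The two extra constants \<open>\<bottom>\<close> and \<open>\<top>\<close> are not the lattice bounds; those are \<open>\<zero>\<close> and \<open>\<one>\<close>.\<close>

record 'a dfg = "'a de_morgan" +
  bt :: 'a ("\<bottom>\<index>")
  tp :: 'a ("\<top>\<index>")

locale bounded_distrib_lattice =
  fixes L (structure)
  assumes meet_closed: "\<lbrakk>x \<in> carrier L; y \<in> carrier L\<rbrakk> \<Longrightarrow> x \<sqinter> y \<in> carrier L"
    and join_closed: "\<lbrakk>x \<in> carrier L; y \<in> carrier L\<rbrakk> \<Longrightarrow> x \<squnion> y \<in> carrier L"
    and zero_closed: "\<zero> \<in> carrier L"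
    and one_closed: "\<one> \<in> carrier L"
    and meet_assoc: "\<lbrakk>x \<in> carrier L; y \<in> carrier L; z \<in> carrier L\<rbrakk>
      \<Longrightarrow> (x \<sqinter> y) \<sqinter> z = x \<sqinter> (y \<sqinter> z)"
    and join_assoc: "\<lbrakk>x \<in> carrier L; y \<in> carrier L; z \<in> carrier L\<rbrakk>
      \<Longrightarrow> (x \<squnion> y) \<squnion> z = x \<squnion> (y \<squnion> z)"
    and meet_comm: "\<lbrakk>x \<in> carrier L; y \<in> carrier L\<rbrakk> \<Longrightarrow> x \<sqinter> y = y \<sqinter> x"
    and join_comm: "\<lbrakk>x \<in> carrier L; y \<in> carrier L\<rbrakk> \<Longrightarrow> x \<squnion> y = y \<squnion> x"
    and meet_absorb: "\<lbrakk>x \<in> carrier L; y \<in> carrier L\<rbrakk> \<Longrightarrow> x \<sqinter> (x \<squnion> y) = x"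
    and join_absorb: "\<lbrakk>x \<in> carrier L; y \<in> carrier L\<rbrakk> \<Longrightarrow> x \<squnion> (x \<sqinter> y) = x"
    and meet_distrib: "\<lbrakk>x \<in> carrier L; y \<in> carrier L; z \<in> carrier L\<rbrakk>
      \<Longrightarrow> x \<sqinter> (y \<squnion> z) = (x \<sqinter> y) \<squnion> (x \<sqinter> z)"
    and zero_join: "x \<in> carrier L \<Longrightarrow> \<zero> \<squnion> x = x"
    and one_meet: "x \<in> carrier L \<Longrightarrow> \<one> \<sqinter> x = x"

locale de_morgan_algebra = bounded_distrib_lattice A for A (structure) +
  assumes neg_closed: "x \<in> carrier A \<Longrightarrow> \<sim> x \<in> carrier A"
    and neg_neg: "x \<in> carrier A \<Longrightarrow> \<sim> (\<sim> x) = x"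
    and neg_meet: "\<lbrakk>x \<in> carrier A; y \<in> carrier A\<rbrakk> \<Longrightarrow> \<sim> (x \<sqinter> y) = (\<sim> x) \<squnion> (\<sim> y)"

locale dfg_algebra = de_morgan_algebra A for A (structure) +
  assumes bt_closed: "\<bottom> \<in> carrier A"
    and tp_closed: "\<top> \<in> carrier A"
    and neg_bt: "\<sim> \<bottom> = \<bottom>"
    and neg_tp: "\<sim> \<top> = \<top>"
    and bt_meet_tp: "\<bottom> \<sqinter> \<top> = \<zero>"

definition dfg_subuniverse :: "'a set \<Rightarrow> ('a, 'm) dfg_scheme \<Rightarrow> bool" where
  "dfg_subuniverse S A \<longleftrightarrow>
     S \<subseteq> carrier A \<and>
     (\<forall>x\<in>S. \<forall>y\<in>S. x \<sqinter>\<^bsub>A\<^esub> y \<in> S) \<and>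
     (\<forall>x\<in>S. \<forall>y\<in>S. x \<squnion>\<^bsub>A\<^esub> y \<in> S) \<and>
     (\<forall>x\<in>S. \<sim>\<^bsub>A\<^esub> x \<in> S) \<and>
     \<zero>\<^bsub>A\<^esub> \<in> S \<and> \<one>\<^bsub>A\<^esub> \<in> S \<and> \<bottom>\<^bsub>A\<^esub> \<in> S \<and> \<top>\<^bsub>A\<^esub> \<in> S"

definition dfg_subalgebra :: "'a dfg \<Rightarrow> 'a dfg \<Rightarrow> bool" where
  "dfg_subalgebra C A \<longleftrightarrow> (\<exists>S. dfg_subuniverse S A \<and> C = A\<lparr>carrier := S\<rparr>)"

definition dfg_hom :: "('a, 'm) dfg_scheme \<Rightarrow> ('b, 'n) dfg_scheme \<Rightarrow> ('a \<Rightarrow> 'b) set" where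
  "dfg_hom A B = {h.
     (\<forall>x\<in>carrier A. h x \<in> carrier B) \<and>
     (\<forall>x\<in>carrier A. \<forall>y\<in>carrier A. h (x \<sqinter>\<^bsub>A\<^esub> y) = h x \<sqinter>\<^bsub>B\<^esub> h y) \<and>
     (\<forall>x\<in>carrier A. \<forall>y\<in>carrier A. h (x \<squnion>\<^bsub>A\<^esub> y) = h x \<squnion>\<^bsub>B\<^esub> h y) \<and>
     (\<forall>x\<in>carrier A. h (\<sim>\<^bsub>A\<^esub> x) = \<sim>\<^bsub>B\<^esub> (h x)) \<and>
     h \<zero>\<^bsub>A\<^esub> = \<zero>\<^bsub>B\<^esub> \<and> h \<one>\<^bsub>A\<^esub> = \<one>\<^bsub>B\<^esub> \<and> h \<bottom>\<^bsub>A\<^esub> = \<bottom>\<^bsub>B\<^esub> \<and> h \<top>\<^bsub>A\<^esub> = \<top>\<^bsub>B\<^esub>}"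

definition dfg_iso :: "('a, 'm) dfg_scheme \<Rightarrow> ('b, 'n) dfg_scheme \<Rightarrow> ('a \<Rightarrow> 'b) set" where
  "dfg_iso A B = {h. h \<in> dfg_hom A B \<and> bij_betw h (carrier A) (carrier B)}"

definition twist_meet :: "('a, 'm) bounded_lat_scheme \<Rightarrow> 'a \<times> 'a \<Rightarrow> 'a \<times> 'a \<Rightarrow> 'a \<times> 'a" where
  "twist_meet L x y = (fst x \<sqinter>\<^bsub>L\<^esub> fst y, snd x \<squnion>\<^bsub>L\<^esub> snd y)"

definition twist_neg :: "'a \<times> 'a \<Rightarrow> 'a \<times> 'a" where
  "twist_neg x = (snd x, fst x)"

definition full_twist :: "('a, 'm) bounded_lat_scheme \<Rightarrow> ('a \<times> 'a) dfg" where
  "full_twist L =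
     \<lparr>carrier = carrier L \<times> carrier L,
      meet = twist_meet L,
      join = (\<lambda>x y. twist_neg (twist_meet L (twist_neg x) (twist_neg y))),
      zero = (\<zero>\<^bsub>L\<^esub>, \<one>\<^bsub>L\<^esub>),
      one = (\<one>\<^bsub>L\<^esub>, \<zero>\<^bsub>L\<^esub>),
      neg = twist_neg,
      bt = (\<zero>\<^bsub>L\<^esub>, \<zero>\<^bsub>L\<^esub>),
      tp = (\<one>\<^bsub>L\<^esub>, \<one>\<^bsub>L\<^esub>)\<rparr>"

definition dfg_twist_algebra :: "('a \<times> 'a) dfg \<Rightarrow> ('a, 'm) bounded_lat_scheme \<Rightarrow> bool" where
  "dfg_twist_algebra C L \<longleftrightarrow>
     bounded_distrib_lattice L \<and>
     dfg_subalgebra C (full_twist L) \<and>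
     fst ` carrier C = carrier L"

definition diamond :: "('a, 'm) dfg_scheme \<Rightarrow> 'a \<Rightarrow> 'a" where
  "diamond A x = x \<sqinter>\<^bsub>A\<^esub> \<top>\<^bsub>A\<^esub>"

definition diamond_lattice :: "('a, 'm) dfg_scheme \<Rightarrow> 'a bounded_lat" where
  "diamond_lattice A =
     \<lparr>carrier = diamond A ` carrier A,
      meet = meet A,
      join = join A,
      zero = \<zero>\<^bsub>A\<^esub>,
      one = \<top>\<^bsub>A\<^esub>\<rparr>"

definition twist_embedding :: "('a, 'm) dfg_scheme \<Rightarrow> 'a \<Rightarrow> 'a \<times> 'a" where
  "twist_embedding A a = (diamond A a, diamond A (\<sim>\<^bsub>A\<^esub> a))"

end

theory Submission
  imports Defs
begin

text \<open>
  Write \<open>\<Diamond>a = a \<sqinter> \<top>\<close>. The map \<open>\<iota> a = (\<Diamond>a, \<Diamond>(\<sim>a))\<close> records the part of \<open>a\<close> below \<open>\<top>\<close> and,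
  since \<open>\<top>\<close> is a fixpoint of negation, also the part above it: \<open>\<sim>(\<Diamond>(\<sim>a)) = a \<squnion> \<top>\<close>. In a distributive
  lattice an element is determined by its meet and its join with a fixed element, so \<open>\<iota>\<close> is injective.

  By distributivity \<open>\<Diamond>\<close> preserves meets and joins. The De Morgan laws turn this, in the
  second coordinate, into the exchange of the two operations that defines the twist product, while
  involutivity makes negation swap the coordinates. Thus \<open>\<iota>\<close> is a homomorphism into the full twist
  algebra; the axiom \<open>\<bottom> \<sqinter> \<top> = \<zero>\<close> says exactly that \<open>\<bottom>\<close> is sent to the pair \<open>(\<zero>, \<zero>)\<close>.
  Consequently the image of \<open>\<iota>\<close> is a subalgebra isomorphic to \<open>A\<close>, and its first projection
  is all of \<open>\<Diamond>[A]\<close> by the definition of \<open>\<iota>\<close>.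
\<close>

context bounded_distrib_lattice
begin

lemma meet_idem:
  assumes "x \<in> carrier L"
  shows "x \<sqinter> x = x"
  using assms by (metis join_absorb meet_absorb meet_closed)

lemma zero_meet:
  assumes "x \<in> carrier L"
  shows "\<zero> \<sqinter> x = \<zero>"
  using assms by (metis meet_absorb zero_closed zero_join)

lemma meet_left_commute:
  assumes "x \<in> carrier L" "y \<in> carrier L" "z \<in> carrier L"
  shows "x \<sqinter> (y \<sqinter> z) = y \<sqinter> (x \<sqinter> z)"
  using assms by (metis meet_assoc meet_comm)

lemma meet_distrib_right:
  assumes "x \<in> carrier L" "y \<in> carrier L" "z \<in> carrier L"
  shows "(x \<squnion> y) \<sqinter> z = (x \<sqinter> z) \<squnion> (y \<sqinter> z)"
  using assms by (simp add: meet_comm[of _ z] meet_distrib join_closed)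

lemma meet_meet_distrib_right:
  assumes "x \<in> carrier L" "y \<in> carrier L" "z \<in> carrier L"
  shows "(x \<sqinter> y) \<sqinter> z = (x \<sqinter> z) \<sqinter> (y \<sqinter> z)"
proof -
  have "(x \<sqinter> z) \<sqinter> (y \<sqinter> z) = x \<sqinter> (y \<sqinter> (z \<sqinter> z))"
    using assms by (simp add: meet_assoc meet_closed meet_left_commute)
  also have "\<dots> = (x \<sqinter> y) \<sqinter> z"
    using assms by (simp add: meet_idem meet_assoc)
  finally show ?thesis by simp
qed

text \<open>
  Absorption gives \<open>x = x \<sqinter> (x \<squnion> t)\<close>; replacing the join by \<open>y \<squnion> t\<close> and distributing yields
  \<open>x = (x \<sqinter> y) \<squnion> (x \<sqinter> t)\<close>, which is symmetric in \<open>x\<close> and \<open>y\<close> because the meets with \<open>t\<close> agree.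
\<close>

lemma meet_join_cancel:
  assumes x: "x \<in> carrier L" and y: "y \<in> carrier L" and t: "t \<in> carrier L"
    and meet_eq: "x \<sqinter> t = y \<sqinter> t" and join_eq: "x \<squnion> t = y \<squnion> t"
  shows "x = y"
proof -
  have "x = x \<sqinter> (y \<squnion> t)"
    using x t meet_absorb[of x t] by (simp add: join_eq)
  also have "\<dots> = (x \<sqinter> y) \<squnion> (x \<sqinter> t)"
    using x y t by (simp add: meet_distrib)
  also have "\<dots> = (y \<sqinter> x) \<squnion> (y \<sqinter> t)"
    using x y by (simp add: meet_eq meet_comm)
  also have "\<dots> = y \<sqinter> (x \<squnion> t)"
    using x y t by (simp add: meet_distrib)
  also have "\<dots> = y"
    using y t by (simp add: join_eq meet_absorb)
  finally show ?thesis .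
qed

end

context de_morgan_algebra
begin

lemma neg_join:
  assumes "x \<in> carrier A" "y \<in> carrier A"
  shows "\<sim> (x \<squnion> y) = (\<sim> x) \<sqinter> (\<sim> y)"
  using assms by (metis meet_closed neg_closed neg_meet neg_neg)

lemma neg_one: "\<sim> \<one> = \<zero>"
proof -
  have "\<sim> \<one> = \<zero> \<squnion> \<sim> \<one>"
    by (simp add: zero_join neg_closed one_closed)
  also have "\<dots> = \<sim> (\<sim> \<zero> \<sqinter> \<one>)"
    by (simp add: neg_meet neg_neg neg_closed zero_closed one_closed)
  also have "\<dots> = \<zero>"
    by (simp add: meet_comm[of _ \<one>] one_meet neg_neg neg_closed zero_closed one_closed)
  finally show ?thesis .
qed

lemma neg_zero: "\<sim> \<zero> = \<one>"
  using neg_one neg_neg one_closed by metis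

end

context dfg_algebra
begin

lemma diamond_closed:
  assumes "x \<in> carrier A"
  shows "diamond A x \<in> carrier A"
  using assms by (simp add: diamond_def meet_closed tp_closed)

lemma diamond_meet:
  assumes "x \<in> carrier A" "y \<in> carrier A"
  shows "diamond A (x \<sqinter> y) = diamond A x \<sqinter> diamond A y"
  using assms by (simp add: diamond_def meet_meet_distrib_right tp_closed)

lemma diamond_join:
  assumes "x \<in> carrier A" "y \<in> carrier A"
  shows "diamond A (x \<squnion> y) = diamond A x \<squnion> diamond A y"
  using assms by (simp add: diamond_def meet_distrib_right tp_closed)

lemma diamond_zero: "diamond A \<zero> = \<zero>"
  by (simp add: diamond_def zero_meet tp_closed)

lemma diamond_one: "diamond A \<one> = \<top>"
  by (simp add: diamond_def one_meet tp_closed)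

lemma diamond_bt: "diamond A \<bottom> = \<zero>"
  by (simp add: diamond_def bt_meet_tp)

lemma diamond_tp: "diamond A \<top> = \<top>"
  by (simp add: diamond_def meet_idem tp_closed)

text \<open>
  Because \<open>\<top>\<close> is its own negation, the second coordinate of the embedding encodes \<open>x \<squnion> \<top>\<close>.
\<close>

lemma neg_diamond_neg:
  assumes "x \<in> carrier A"
  shows "\<sim> (diamond A (\<sim> x)) = x \<squnion> \<top>"
  using assms by (simp add: diamond_def neg_meet neg_neg neg_tp neg_closed tp_closed)

lemma bounded_distrib_lattice_diamond_lattice:
  "bounded_distrib_lattice (diamond_lattice A)"
proof -
  let ?D = "diamond A ` carrier A"
  have sub: "x \<in> carrier A" if "x \<in> ?D" for x
    using that diamond_closed by auto
  have meet_D: "x \<sqinter> y \<in> ?D" if "x \<in> ?D" "y \<in> ?D" for x y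
    using that by (auto simp flip: diamond_meet intro: meet_closed)
  have join_D: "x \<squnion> y \<in> ?D" if "x \<in> ?D" "y \<in> ?D" for x y
    using that by (auto simp flip: diamond_join intro: join_closed)
  have zero_D: "\<zero> \<in> ?D"
    using diamond_zero zero_closed by (metis imageI)
  have tp_D: "\<top> \<in> ?D"
    using diamond_tp tp_closed by (metis imageI)
  have tp_meet: "\<top> \<sqinter> x = x" if "x \<in> ?D" for x
  proof -
    from that obtain a where a: "a \<in> carrier A" and x: "x = diamond A a" by auto
    have "\<top> \<sqinter> x = diamond A (\<one> \<sqinter> a)"
      using a x by (simp add: diamond_meet diamond_one one_closed)
    then show ?thesis
      using a x by (simp add: one_meet)
  qed
  show ?thesis
    unfolding bounded_distrib_lattice_def diamond_lattice_def
    by (simp add: meet_D join_D zero_D tp_D tp_meet sub meet_assoc join_assoc meet_absorb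
        join_absorb meet_distrib zero_join) (blast intro: sub meet_comm join_comm)
qed

lemma twist_embedding_hom:
  "twist_embedding A \<in> dfg_hom A (full_twist (diamond_lattice A))"
  by (simp add: dfg_hom_def twist_embedding_def full_twist_def diamond_lattice_def twist_meet_def
      twist_neg_def diamond_meet diamond_join diamond_zero diamond_one diamond_bt diamond_tp
      neg_meet neg_join neg_neg neg_zero neg_one neg_bt neg_tp neg_closed)

lemma inj_on_twist_embedding: "inj_on (twist_embedding A) (carrier A)"
proof (rule inj_onI)
  fix x y
  assume x: "x \<in> carrier A" and y: "y \<in> carrier A"
    and eq: "twist_embedding A x = twist_embedding A y"
  have "x \<sqinter> \<top> = y \<sqinter> \<top>"
    using eq by (simp add: twist_embedding_def diamond_def)
  moreover have "x \<squnion> \<top> = y \<squnion> \<top>"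
    using eq x y by (simp add: twist_embedding_def flip: neg_diamond_neg)
  ultimately show "x = y"
    using x y tp_closed by (metis meet_join_cancel)
qed

lemma hom_image_subuniverse:
  assumes h: "h \<in> dfg_hom A B"
  shows "dfg_subuniverse (h ` carrier A) B"
proof -
  have sub: "h ` carrier A \<subseteq> carrier B"
    using h by (auto simp: dfg_hom_def)
  have meet: "h x \<sqinter>\<^bsub>B\<^esub> h y \<in> h ` carrier A"
    and join: "h x \<squnion>\<^bsub>B\<^esub> h y \<in> h ` carrier A" if "x \<in> carrier A" "y \<in> carrier A" for x y
  proof -
    have "h x \<sqinter>\<^bsub>B\<^esub> h y = h (x \<sqinter> y)" "h x \<squnion>\<^bsub>B\<^esub> h y = h (x \<squnion> y)"
      using h that by (simp_all add: dfg_hom_def)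
    then show "h x \<sqinter>\<^bsub>B\<^esub> h y \<in> h ` carrier A" "h x \<squnion>\<^bsub>B\<^esub> h y \<in> h ` carrier A"
      using that by (simp_all add: meet_closed join_closed)
  qed
  have neg: "\<sim>\<^bsub>B\<^esub> (h x) \<in> h ` carrier A" if "x \<in> carrier A" for x
  proof -
    have "\<sim>\<^bsub>B\<^esub> (h x) = h (\<sim> x)"
      using h that by (simp add: dfg_hom_def)
    then show ?thesis
      using that by (simp add: neg_closed)
  qed
  have "\<zero>\<^bsub>B\<^esub> = h \<zero>" "\<one>\<^bsub>B\<^esub> = h \<one>" "\<bottom>\<^bsub>B\<^esub> = h \<bottom>" "\<top>\<^bsub>B\<^esub> = h \<top>"
    using h by (simp_all add: dfg_hom_def)
  then have constants: "\<zero>\<^bsub>B\<^esub> \<in> h ` carrier A" "\<one>\<^bsub>B\<^esub> \<in> h ` carrier A"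
      "\<bottom>\<^bsub>B\<^esub> \<in> h ` carrier A" "\<top>\<^bsub>B\<^esub> \<in> h ` carrier A"
    by (simp_all add: zero_closed one_closed bt_closed tp_closed)
  show ?thesis
    unfolding dfg_subuniverse_def using sub meet join neg constants by blast
qed

end

lemma inj_hom_iso_image:
  assumes "h \<in> dfg_hom A B" and "inj_on h (carrier A)"
  shows "h \<in> dfg_iso A (B\<lparr>carrier := h ` carrier A\<rparr>)"
  using assms by (simp add: dfg_iso_def dfg_hom_def bij_betw_def)

theorem theorem44:
  fixes A :: "'a dfg"
  assumes "dfg_algebra A"
  shows "\<exists>C. dfg_twist_algebra C (diamond_lattice A) \<and> twist_embedding A \<in> dfg_iso A C"
proof -
  interpret dfg_algebra A by (rule assms)
  let ?T = "full_twist (diamond_lattice A)"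
  let ?C = "?T\<lparr>carrier := twist_embedding A ` carrier A\<rparr>"
  have "dfg_subalgebra ?C ?T"
    unfolding dfg_subalgebra_def using hom_image_subuniverse[OF twist_embedding_hom] by blast
  moreover have "fst ` carrier ?C = carrier (diamond_lattice A)"
    by (simp add: diamond_lattice_def twist_embedding_def image_image)
  ultimately have "dfg_twist_algebra ?C (diamond_lattice A)"
    unfolding dfg_twist_algebra_def using bounded_distrib_lattice_diamond_lattice by blast
  moreover have "twist_embedding A \<in> dfg_iso A ?C"
    by (rule inj_hom_iso_image[OF twist_embedding_hom inj_on_twist_embedding])
  ultimately show ?thesis by blast
qed

end
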